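(* For any semigroup $S$, $\Gamma(S)$ is a null graph if and only if $S$ is a band.
   Context: For a subset $X$ of a semigroup $S$, $\langle X\rangle$ denotes the subsemigroup generated by $X$; a semigroup is monogenic if it equals $\langle a\rangle=\{a^k : k\in\mathbb{N}\}$ for some element $a$, where $\mathbb{N}=\{1,2,\dots\}$. The cyclic graph $\Gamma(S)$ is the simple undirected graph with vertex set $S$ in which two distinct vertices $x,y$ are adjacent if and only if $\langle x,y\rangle$ is a monogenic subsemigroup of $S$. A null graph is a graph with no edges. A band is a semigroup in which every element is idempotent. *)

theory Defs
  imports Main "HOL.Hull" "Graph_Theory.Pair_Digraph"
begin

text \<open>
  A semigroup is an associative operation on a type, as expressed by the locale
  \<^locale>\<open>semigroup\<close>.
\<close>

definition subsemigroup :: "('a \<Rightarrow> 'a \<Rightarrow> 'a) \<Rightarrow> 'a set \<Rightarrow> bool" where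
  "subsemigroup f T \<longleftrightarrow> (\<forall>x\<in>T. \<forall>y\<in>T. f x y \<in> T)"

definition generated :: "('a \<Rightarrow> 'a \<Rightarrow> 'a) \<Rightarrow> 'a set \<Rightarrow> 'a set" where
  "generated f X = subsemigroup f hull X"

definition monogenic :: "('a \<Rightarrow> 'a \<Rightarrow> 'a) \<Rightarrow> 'a set \<Rightarrow> bool" where
  "monogenic f T \<longleftrightarrow> (\<exists>a. T = generated f {a})"

text \<open>
  The elements of \<open>generated f {a}\<close> are the powers of \<open>a\<close> with positive exponent;
  \<open>(f a ^^ k) a\<close> is the power with exponent \<open>k + 1\<close>.
\<close>

lemma (in semigroup) generated_singleton:
  "generated f {a} = range (\<lambda>k. (f a ^^ k) a)"
proof -
  have add: "f ((f a ^^ i) a) ((f a ^^ j) a) = (f a ^^ (i + Suc j)) a" for i j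
    by (induction i) (simp_all add: assoc)
  have closed: "subsemigroup f (range (\<lambda>k. (f a ^^ k) a))"
    unfolding subsemigroup_def using add by blast
  have mem: "a \<in> range (\<lambda>k. (f a ^^ k) a)"
    by (rule range_eqI [where x = 0]) simp
  have "(f a ^^ k) a \<in> T" if "subsemigroup f T" "a \<in> T" for k T
    using that by (induction k) (auto simp: subsemigroup_def)
  then show ?thesis
    unfolding generated_def using closed mem by (intro hull_unique) auto
qed

text \<open>
  A simple undirected graph, possibly infinite, is represented by its symmetric and
  irreflexive set of arcs, that is, by a \<^locale>\<open>pair_bidirected_digraph\<close>.
\<close>

definition cyclic_graph :: "('a \<Rightarrow> 'a \<Rightarrow> 'a) \<Rightarrow> 'a pair_pre_digraph" where
  "cyclic_graph f =
    \<lparr> pverts = UNIV, parcs = {(x, y). x \<noteq> y \<and> monogenic f (generated f {x, y})} \<rparr>"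

lemma pair_bidirected_digraph_cyclic_graph: "pair_bidirected_digraph (cyclic_graph f)"
  by unfold_locales
    (auto simp: cyclic_graph_def symmetric_def with_proj_simps sym_def insert_commute)

definition null_graph :: "'a pair_pre_digraph \<Rightarrow> bool" where
  "null_graph G \<longleftrightarrow> parcs G = {}"

locale band = semigroup +
  assumes idem: "f a a = a"

end

theory Submission
  imports Defs
begin

text \<open>
  Adjoining \<open>a\<^sup>2\<close> to a generator \<open>a\<close> does not enlarge the generated subsemigroup, so
  \<open>a\<close> and \<open>a\<^sup>2\<close> are adjacent as soon as they are distinct. An edgeless graph therefore forces
  every element to be idempotent. Conversely, all positive powers of an idempotent coincide,
  so in a band every monogenic subsemigroup is a singleton and cannot contain both ends of an
  edge.
\<close>

lemma generated_insert_square: "generated f {a, f a a} = generated f {a}"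
proof -
  have "subsemigroup f T \<and> {a, f a a} \<subseteq> T \<longleftrightarrow> subsemigroup f T \<and> {a} \<subseteq> T" for T
    by (auto simp: subsemigroup_def)
  then show ?thesis
    unfolding generated_def hull_def by presburger
qed

lemma (in semigroup) generated_idempotent:
  assumes "f a a = a"
  shows "generated f {a} = {a}"
proof -
  have "(f a ^^ k) a = a" for k
    by (induction k) (simp_all add: assms)
  then show ?thesis
    by (simp add: generated_singleton)
qed

theorem corollary3p4:
  fixes f :: "'a \<Rightarrow> 'a \<Rightarrow> 'a"
  assumes "semigroup f"
  shows "null_graph (cyclic_graph f) \<longleftrightarrow> band f"
proof
  assume null: "null_graph (cyclic_graph f)"
  have "f a a = a" for a
  proof (rule ccontr)
    assume "f a a \<noteq> a"
    moreover have "monogenic f (generated f {a, f a a})"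
      unfolding monogenic_def by (intro exI [of _ a] generated_insert_square)
    ultimately have "(a, f a a) \<in> parcs (cyclic_graph f)"
      by (auto simp: cyclic_graph_def)
    with null show False
      by (simp add: null_graph_def)
  qed
  with assms show "band f"
    by (simp add: band_def band_axioms_def)
next
  assume "band f"
  then interpret band f .
  have not_monogenic: "\<not> monogenic f (generated f {x, y})" if "x \<noteq> y" for x y
  proof
    assume "monogenic f (generated f {x, y})"
    then obtain a where "generated f {x, y} = generated f {a}"
      unfolding monogenic_def by (elim exE)
    then have "generated f {x, y} = {a}"
      by (simp only: generated_idempotent [OF idem])
    moreover have "{x, y} \<subseteq> generated f {x, y}"
      unfolding generated_def by (rule hull_subset)
    ultimately have "x = y"
      by simp
    with that show False ..
  qed
  have "parcs (cyclic_graph f) \<subseteq> {}"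
  proof (rule subrelI)
    fix x y
    assume "(x, y) \<in> parcs (cyclic_graph f)"
    then show "(x, y) \<in> {}"
      using not_monogenic [of x y] by (auto simp: cyclic_graph_def)
  qed
  then show "null_graph (cyclic_graph f)"
    unfolding null_graph_def by (rule subset_empty [THEN iffD1])
qed

end
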